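(* Let $N\ge 2$, $p\ge 2$, $0<r_0<R_0\le\infty$, $\Omega=B]r_0,R_0[$, and let $V\in C(\Omega)$ with $V\ge 0$. Assume that there exists a positive radial strictly monotone increasing $C^2$ strict supersolution of $-\Delta_p w-V|w|^{p-2}w=0$ in $\Omega$. Let $u$ be a radial monotone increasing $C^2$-subsolution of this equation with $u(r_0)\ge 0$. Then at least one of the following alternatives occurs: (i) for every positive radial strictly monotone increasing $C^2$ strict supersolution $v$ of the equation, there exists $C>0$ such that $u(r)\le C\,v(r)$ for all $r\in[r_0,R_0[$; (ii) for every positive (not necessarily radial or increasing) $C^2$-supersolution $w$ of the equation, $u$ is not smaller than $w$, i.e. $$\limsup_{|x|\to R_0}\frac{u(x)}{w(x)}>0.$$
   Context: $\Delta_p w=\nabla\cdot(|\nabla w|^{p-2}\nabla w)$. For $0<r_0<R_0\le\infty$, $B]r_0,R_0[=\{x\in\mathbb{R}^N: r_0<|x|<R_0\}$ and $B[r_0,R_0[=\{x: r_0\le|x|<R_0\}$. A $C^2$-subsolution (resp. supersolution) in $\Omega=B]r_0,R_0[$ is a function $w\in C^2(B[r_0,R_0[)$ with $-\Delta_p w-V|w|^{p-2}w\le 0$ (resp. $\ge 0$) pointwise in $\Omega$; a strict supersolution satisfies $-\Delta_p w-V|w|^{p-2}w>0$ at every point of $\Omega$. A radial function $w(x)=\phi(|x|)$ is identified with $\phi$, with $w'(r)=\phi'(r)$; it is monotone increasing if $w'(r)\ge 0$ and strictly monotone increasing if $w'(r)>0$ for all $r\in[r_0,R_0[$. *)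

theory Defs
  imports "HOL-Analysis.Analysis"
begin

definition annulus_open :: "real \<Rightarrow> ereal \<Rightarrow> 'a::euclidean_space set" where
  "annulus_open r0 R0 = {x. r0 < norm x \<and> ereal (norm x) < R0}"

definition annulus_hc :: "real \<Rightarrow> ereal \<Rightarrow> 'a::euclidean_space set" where
  "annulus_hc r0 R0 = {x. r0 \<le> norm x \<and> ereal (norm x) < R0}"

text \<open>Power a^e for a >= 0 with the convention a^0 = 1 (Isabelle has 0 powr 0 = 0).\<close>
definition spow :: "real \<Rightarrow> real \<Rightarrow> real" where
  "spow a e = (if e = 0 then 1 else a powr e)"

definition C2_on :: "'a::euclidean_space set \<Rightarrow> ('a \<Rightarrow> real) \<Rightarrow> bool" where
  "C2_on S f \<longleftrightarrow> (\<exists>g H. (\<forall>x\<in>S. (f has_derivative (\<lambda>h. g x \<bullet> h)) (at x within S)) \<and>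
                         (\<forall>x\<in>S. (g has_derivative H x) (at x within S)) \<and>
                         (\<forall>i\<in>Basis. continuous_on S (\<lambda>x. H x i)))"

definition grad :: "('a::euclidean_space \<Rightarrow> real) \<Rightarrow> 'a \<Rightarrow> 'a" where
  "grad f x = (\<Sum>i\<in>Basis. frechet_derivative f (at x) i *\<^sub>R i)"

definition divg :: "('a::euclidean_space \<Rightarrow> 'a) \<Rightarrow> 'a \<Rightarrow> real" where
  "divg F x = (\<Sum>i\<in>Basis. frechet_derivative F (at x) i \<bullet> i)"

definition plap :: "real \<Rightarrow> ('a::euclidean_space \<Rightarrow> real) \<Rightarrow> 'a \<Rightarrow> real" where
  "plap p w x = divg (\<lambda>y. spow (norm (grad w y)) (p - 2) *\<^sub>R grad w y) x"

definition Lop :: "real \<Rightarrow> ('a::euclidean_space \<Rightarrow> real) \<Rightarrow> ('a \<Rightarrow> real) \<Rightarrow> 'a \<Rightarrow> real" where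
  "Lop p V w x = - plap p w x - V x * spow \<bar>w x\<bar> (p - 2) * w x"

definition C2_subsol :: "real \<Rightarrow> ('a::euclidean_space \<Rightarrow> real) \<Rightarrow> real \<Rightarrow> ereal \<Rightarrow> ('a \<Rightarrow> real) \<Rightarrow> bool" where
  "C2_subsol p V r0 R0 w \<longleftrightarrow> C2_on (annulus_hc r0 R0) w \<and>
     (\<forall>x\<in>annulus_open r0 R0. Lop p V w x \<le> 0)"

definition C2_supersol :: "real \<Rightarrow> ('a::euclidean_space \<Rightarrow> real) \<Rightarrow> real \<Rightarrow> ereal \<Rightarrow> ('a \<Rightarrow> real) \<Rightarrow> bool" where
  "C2_supersol p V r0 R0 w \<longleftrightarrow> C2_on (annulus_hc r0 R0) w \<and>
     (\<forall>x\<in>annulus_open r0 R0. Lop p V w x \<ge> 0)"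

definition C2_strict_supersol :: "real \<Rightarrow> ('a::euclidean_space \<Rightarrow> real) \<Rightarrow> real \<Rightarrow> ereal \<Rightarrow> ('a \<Rightarrow> real) \<Rightarrow> bool" where
  "C2_strict_supersol p V r0 R0 w \<longleftrightarrow> C2_on (annulus_hc r0 R0) w \<and>
     (\<forall>x\<in>annulus_open r0 R0. Lop p V w x > 0)"

definition radial_with :: "real \<Rightarrow> ereal \<Rightarrow> ('a::euclidean_space \<Rightarrow> real) \<Rightarrow> (real \<Rightarrow> real) \<Rightarrow> bool" where
  "radial_with r0 R0 w \<phi> \<longleftrightarrow> (\<forall>x\<in>annulus_hc r0 R0. w x = \<phi> (norm x))"

definition radial_mono_incr :: "real \<Rightarrow> ereal \<Rightarrow> ('a::euclidean_space \<Rightarrow> real) \<Rightarrow> bool" where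
  "radial_mono_incr r0 R0 w \<longleftrightarrow> (\<exists>\<phi>. radial_with r0 R0 w \<phi> \<and>
     (\<forall>r. r0 \<le> r \<and> ereal r < R0 \<longrightarrow> (\<exists>d. (\<phi> has_real_derivative d) (at r within {r0..}) \<and> d \<ge> 0)))"

definition radial_strict_mono_incr :: "real \<Rightarrow> ereal \<Rightarrow> ('a::euclidean_space \<Rightarrow> real) \<Rightarrow> bool" where
  "radial_strict_mono_incr r0 R0 w \<longleftrightarrow> (\<exists>\<phi>. radial_with r0 R0 w \<phi> \<and>
     (\<forall>r. r0 \<le> r \<and> ereal r < R0 \<longrightarrow> (\<exists>d. (\<phi> has_real_derivative d) (at r within {r0..}) \<and> d > 0)))"

definition to_outer :: "ereal \<Rightarrow> 'a::euclidean_space filter" where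
  "to_outer R0 = filtercomap (\<lambda>x. ereal (norm x)) (at_left R0)"

end

theory Submission
  imports Defs
begin

text \<open>
  If \<open>u/v\<close> is unbounded for a radial increasing strict supersolution \<open>v\<close>, pick \<open>\<tau>\<close> larger than
  the value of \<open>u/v\<close> on the inner sphere. Since \<open>u\<close> cannot touch a positive multiple of \<open>v\<close> from
  below, \<open>u/v\<close> has no positive interior maximum, hence \<open>u/v\<close> does not decrease where it exceeds
  \<open>\<tau>\<close>; there \<open>z = u - \<tau> v\<close> is positive with a positive radial derivative. At such points \<open>z\<close> is a
  strict subsolution: all gradients are parallel to \<open>x\<close>, so after division by \<open>|w'| ^ (p - 2)\<close> the
  second-order part is linear in the Hessian, and the zero-order part \<open>w (w / w') ^ (p - 2)\<close> is
  subadditive in \<open>(w, w')\<close>, being the perspective of a convex power. If a positive supersolution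
  \<open>w\<close> had \<open>limsup u/w \<le> 0\<close>, then \<open>z/w\<close> would attain a positive interior maximum, where a
  multiple of \<open>w\<close> touches \<open>z\<close> from above; this is impossible. Only points with nonzero gradient
  occur, so the degeneracy of the operator plays no role.
\<close>

section \<open>Second-order jets and touching from above\<close>

definition second_jet :: "('a::euclidean_space \<Rightarrow> real) \<Rightarrow> 'a \<Rightarrow> 'a \<Rightarrow> ('a \<Rightarrow> 'a) \<Rightarrow> bool" where
  "second_jet f x g H \<longleftrightarrow> (\<exists>S G. open S \<and> x \<in> S \<and>
     (\<forall>y\<in>S. (f has_derivative (\<lambda>h. G y \<bullet> h)) (at y)) \<and> G x = g \<and> (G has_derivative H) (at x))"

text \<open>The second-order part of the operator divided by \<open>|g| ^ (p - 2)\<close>, where \<open>e = sgn g\<close>.\<close>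
definition hess_op :: "real \<Rightarrow> ('a::euclidean_space \<Rightarrow> 'a) \<Rightarrow> 'a \<Rightarrow> real" where
  "hess_op p H e = (\<Sum>i\<in>Basis. H i \<bullet> i) + (p - 2) * (H e \<bullet> e)"

text \<open>The zero-order term divided by the power \<open>p - 2\<close> of the gradient norm:
  \<open>a\<close> stands for the function value, \<open>b\<close> for the gradient norm. At
  positive arguments \<open>p = 2\<close> gives just \<open>a\<close>.\<close>

definition reaction :: "real \<Rightarrow> real \<Rightarrow> real \<Rightarrow> real" where
  "reaction p a b = a * (a / b) powr (p - 2)"

lemma second_jet_diff_scaled:
  assumes "second_jet f x g H" "second_jet f' x g' H'"
  shows "second_jet (\<lambda>y. f y - c * f' y) x (g - c *\<^sub>R g') (\<lambda>h. H h - c *\<^sub>R H' h)"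
proof -
  obtain S G where S: "open S" "x \<in> S" "\<And>y. y \<in> S \<Longrightarrow> (f has_derivative (\<lambda>h. G y \<bullet> h)) (at y)"
    "G x = g" "(G has_derivative H) (at x)"
    using assms(1) unfolding second_jet_def by blast
  obtain S' G' where S': "open S'" "x \<in> S'" "\<And>y. y \<in> S' \<Longrightarrow> (f' has_derivative (\<lambda>h. G' y \<bullet> h)) (at y)"
    "G' x = g'" "(G' has_derivative H') (at x)"
    using assms(2) unfolding second_jet_def by blast
  have "\<forall>y\<in>S \<inter> S'. ((\<lambda>y. f y - c * f' y) has_derivative (\<lambda>h. (G y - c *\<^sub>R G' y) \<bullet> h)) (at y)"
    by (auto intro!: derivative_eq_intros S(3) S'(3) simp: inner_diff_left)
  moreover have "((\<lambda>y. G y - c *\<^sub>R G' y) has_derivative (\<lambda>h. H h - c *\<^sub>R H' h)) (at x)"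
    by (auto intro!: derivative_eq_intros S(5) S'(5))
  ultimately show ?thesis
    unfolding second_jet_def using S S'
    by (intro exI[of _ "S \<inter> S'"] exI[of _ "\<lambda>y. G y - c *\<^sub>R G' y"]) auto
qed

lemma second_jet_has_derivative:
  "second_jet f x g H \<Longrightarrow> (f has_derivative (\<lambda>h. g \<bullet> h)) (at x)"
  unfolding second_jet_def by blast

text \<open>A jet provides a derivative of the gradient field at \<open>x\<close> only, so the
  second-order condition is proved along a line. The slope of \<open>f\<close> on
  \<open>x + t *\<^sub>R e\<close> vanishes at \<open>t = 0\<close> and has derivative
  \<open>H e \<bullet> e\<close> there. Were this positive, the slope would be positive for small
  \<open>t > 0\<close>, and \<open>f\<close> would rise strictly above its maximum.\<close>

lemma second_jet_local_max:
  fixes f :: "'a::euclidean_space \<Rightarrow> real"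
  assumes "second_jet f x g H" "eventually (\<lambda>y. f y \<le> f x) (nhds x)"
  shows "g = 0" "H e \<bullet> e \<le> 0"
proof -
  obtain S G where S: "open S" "x \<in> S" "\<And>y. y \<in> S \<Longrightarrow> (f has_derivative (\<lambda>h. G y \<bullet> h)) (at y)"
    "G x = g" "(G has_derivative H) (at x)"
    using assms(1) unfolding second_jet_def by blast
  obtain T where T: "open T" "x \<in> T" "\<And>y. y \<in> T \<Longrightarrow> f y \<le> f x"
    using assms(2) unfolding eventually_nhds by blast
  have "(\<lambda>h. g \<bullet> h) = (\<lambda>h. 0)"
    using differential_zero_maxmin[OF T(2,1) second_jet_has_derivative[OF assms(1)]] T(3) by blast
  then have "g \<bullet> g = 0" by (rule fun_cong)
  then show g0: "g = 0" by simp
  show "H e \<bullet> e \<le> 0"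
  proof (rule ccontr)
    assume "\<not> ?thesis"
    then have pos: "H e \<bullet> e > 0" by simp
    define U where "U = (\<lambda>t. x + t *\<^sub>R e) -` (S \<inter> T)"
    have "open U" unfolding U_def
      by (intro open_vimage open_Int S T continuous_intros)
    moreover have "0 \<in> U" using S T by (simp add: U_def)
    ultimately obtain d where d: "d > 0" "ball (0::real) d \<subseteq> U" unfolding open_contains_ball by blast
    have lin: "((\<lambda>t. x + t *\<^sub>R e) has_derivative (\<lambda>t. t *\<^sub>R e)) (at t)" for t :: real
      by (auto intro!: derivative_eq_intros)
    have G': "((\<lambda>t. G (x + t *\<^sub>R e)) has_derivative (\<lambda>t. H (t *\<^sub>R e))) (at 0)"
      using has_derivative_compose[OF lin[of 0], of G H] S(5) by simp
    have "bounded_linear H" using S(5) has_derivative_bounded_linear by blast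
    then have "H (t *\<^sub>R e) = t *\<^sub>R H e" for t
      by (simp add: linear_simps)
    with G' have "((\<lambda>t. G (x + t *\<^sub>R e) \<bullet> e) has_derivative (\<lambda>t. (H e \<bullet> e) * t)) (at 0)"
      by (auto intro!: derivative_eq_intros)
    then have "((\<lambda>t. G (x + t *\<^sub>R e) \<bullet> e) has_real_derivative (H e \<bullet> e)) (at 0)"
      by (simp add: has_field_derivative_def)
    from has_real_derivative_pos_inc_right[OF this pos] g0 S(4)
    obtain d' where d': "d' > 0" "\<And>h. 0 < h \<Longrightarrow> h < d' \<Longrightarrow> G (x + h *\<^sub>R e) \<bullet> e > 0" by auto
    define s where "s = min d d' / 2"
    have s: "0 < s" "s < d" "s < d'" using d d' by (auto simp: s_def)
    have der: "((\<lambda>t. f (x + t *\<^sub>R e)) has_real_derivative (G (x + t *\<^sub>R e) \<bullet> e)) (at t)"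
      if "0 \<le> t" "t \<le> s" for t
    proof -
      have "t \<in> U" using d s that by (auto simp: subset_iff dist_real_def)
      then have "(f has_derivative (\<lambda>h. G (x + t *\<^sub>R e) \<bullet> h)) (at (x + t *\<^sub>R e))"
        by (intro S(3)) (simp add: U_def)
      from has_derivative_compose[OF lin this] show ?thesis
        by (simp add: has_field_derivative_def mult.commute[of _ "G (x + t *\<^sub>R e) \<bullet> e"])
    qed
    have "f (x + 0 *\<^sub>R e) < f (x + s *\<^sub>R e)"
    proof (rule DERIV_pos_imp_increasing_open[OF s(1)])
      show "\<exists>y. ((\<lambda>t. f (x + t *\<^sub>R e)) has_real_derivative y) (at t) \<and> 0 < y" if "0 < t" "t < s" for t
        using der[of t] d'(2)[of t] that s by auto
      show "continuous_on {0..s} (\<lambda>t. f (x + t *\<^sub>R e))"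
        by (rule DERIV_atLeastAtMost_imp_continuous_on) (use der in blast)
    qed
    moreover have "s \<in> U" using d s by (auto simp: subset_iff dist_real_def)
    ultimately show False using T(3)[of "x + s *\<^sub>R e"] by (simp add: U_def)
  qed
qed

lemma hess_op_diff_scaled: "hess_op p (\<lambda>h. H h - c *\<^sub>R H' h) e = hess_op p H e - c * hess_op p H' e"
  unfolding hess_op_def
  by (simp add: inner_diff_left sum_subtractf sum_distrib_left[symmetric] algebra_simps)

text \<open>The difference \<open>f - c f'\<close> has a local maximum at \<open>x\<close>. Its
  Hessian is therefore nonpositive, and \<open>hess_op\<close>, a trace plus a multiple
  \<open>p - 2 \<ge> 0\<close> of a quadratic form, is monotone in the Hessian. The direction
  \<open>e\<close> stays free so that it can later be the common direction of both
  gradients.\<close>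

lemma touching_above:
  fixes f :: "'a::euclidean_space \<Rightarrow> real"
  assumes "second_jet f x g H" "second_jet f' x g' H'" "2 \<le> p"
    and "f x = c * f' x" "eventually (\<lambda>y. f y \<le> c * f' y) (nhds x)"
  shows "g = c *\<^sub>R g'" "hess_op p H e \<le> c * hess_op p H' e"
proof -
  note j = second_jet_diff_scaled[OF assms(1,2), of c]
  have ev: "eventually (\<lambda>y. f y - c * f' y \<le> f x - c * f' x) (nhds x)"
    using assms(5) by eventually_elim (simp add: assms(4))
  show "g = c *\<^sub>R g'" using second_jet_local_max(1)[OF j ev] by simp
  have "hess_op p (\<lambda>h. H h - c *\<^sub>R H' h) e \<le> 0"
    unfolding hess_op_def using second_jet_local_max(2)[OF j ev] assms(3)
    by (intro add_nonpos_nonpos sum_nonpos mult_nonneg_nonpos) auto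
  then show "hess_op p H e \<le> c * hess_op p H' e" by (simp add: hess_op_diff_scaled)
qed

section \<open>The p-Laplacian at points with nonzero gradient\<close>

lemma plap_second_jet:
  fixes f :: "'a::euclidean_space \<Rightarrow> real"
  assumes "second_jet f x g H" "g \<noteq> 0"
  shows "plap p f x = norm g powr (p - 2) * hess_op p H (sgn g)"
proof -
  obtain S G where S: "open S" "x \<in> S" "\<And>y. y \<in> S \<Longrightarrow> (f has_derivative (\<lambda>h. G y \<bullet> h)) (at y)"
    "G x = g" "(G has_derivative H) (at x)"
    using assms(1) unfolding second_jet_def by blast
  have gr: "grad f y = G y" if "y \<in> S" for y
  proof -
    have "frechet_derivative f (at y) = (\<lambda>h. G y \<bullet> h)"
      using frechet_derivative_at[OF S(3)[OF that]] by simp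
    then show ?thesis unfolding grad_def by (simp add: euclidean_representation)
  qed
  define n where "n = norm g"
  have n: "n > 0" using assms(2) by (simp add: n_def)
  \<comment> \<open>Product rule for the flux: since \<open>g \<noteq> 0\<close>, the gradient norm
    is differentiable at \<open>x\<close>, with derivative \<open>H h \<bullet> sgn g\<close> in
    direction \<open>h\<close>.\<close>
  let ?F' = "\<lambda>h. (n powr (p - 2)) *\<^sub>R H h + ((p - 2) * n powr (p - 3) * (H h \<bullet> sgn g)) *\<^sub>R g"
  have bl: "bounded_linear H" using S(5) has_derivative_bounded_linear by blast
  have "isCont G x" using S(5) has_derivative_continuous by blast
  then have "eventually (\<lambda>y. G y \<noteq> 0) (at x)"
    using assms(2) S(4) unfolding isCont_def by (intro tendsto_imp_eventually_ne) auto
  then have "eventually (\<lambda>y. G y \<noteq> 0) (nhds x)"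
    using assms(2) S(4) by (simp add: eventually_nhds_conv_at)
  moreover have "eventually (\<lambda>y. y \<in> S) (nhds x)" using S by (simp add: eventually_nhds_in_open)
  \<comment> \<open>Where \<open>G y\<close> is nonzero, \<open>spow\<close> and \<open>powr\<close>
    agree even for the exponent 0, so near \<open>x\<close> the flux is given by a formula that can
    be differentiated.\<close>
  ultimately have "eventually (\<lambda>y. norm (G y) powr (p - 2) *\<^sub>R G y
       = spow (norm (grad f y)) (p - 2) *\<^sub>R grad f y) (nhds x)"
    by eventually_elim (auto simp: spow_def gr)
  then obtain T where T: "open T" "x \<in> T" "\<And>y. y \<in> T \<Longrightarrow> norm (G y) powr (p - 2) *\<^sub>R G y
       = spow (norm (grad f y)) (p - 2) *\<^sub>R grad f y"
    unfolding eventually_nhds by blast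
  have "((\<lambda>y. norm (G y)) has_derivative (\<lambda>h. H h \<bullet> sgn g)) (at x)"
    using has_derivative_compose[OF S(5) has_derivative_norm] assms(2) S(4) by (simp add: inner_commute)
  then have "((\<lambda>y. norm (G y) powr (p - 2)) has_derivative (\<lambda>h. (p - 2) * n powr (p - 3) * (H h \<bullet> sgn g))) (at x)"
    using has_derivative_compose[of "\<lambda>y. norm (G y)" "\<lambda>h. H h \<bullet> sgn g" x UNIV "\<lambda>s. s powr (p - 2)" "(*) ((p - 2) * n powr (p - 3))"]
      has_real_derivative_powr[OF n, of "p - 2"] n S(4)
    by (simp add: has_field_derivative_def n_def)
  from has_derivative_scaleR[OF this S(5)]
  have "((\<lambda>y. norm (G y) powr (p - 2) *\<^sub>R G y) has_derivative ?F') (at x)"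
    by (simp add: S(4) n_def)
  then have "((\<lambda>y. spow (norm (grad f y)) (p - 2) *\<^sub>R grad f y) has_derivative ?F') (at x)"
    by (rule has_derivative_transform_within_open[OF _ T])
  then have "frechet_derivative (\<lambda>y. spow (norm (grad f y)) (p - 2) *\<^sub>R grad f y) (at x) = ?F'"
    by (rule frechet_derivative_at[symmetric])
  then have "plap p f x = (\<Sum>i\<in>Basis. ?F' i \<bullet> i)"
    by (simp only: plap_def divg_def)
  also have "\<dots> = n powr (p - 2) * (\<Sum>i\<in>Basis. H i \<bullet> i)
     + (p - 2) * n powr (p - 3) * (\<Sum>i\<in>Basis. (g \<bullet> i) * (H i \<bullet> sgn g))"
    by (simp add: inner_add_left sum.distrib sum_distrib_left sum_distrib_right mult_ac)
  \<comment> \<open>By linearity the coordinates recombine to \<open>H g\<close>, and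
    \<open>g = n *\<^sub>R sgn g\<close>; the factor \<open>n\<close> gained raises the exponent
    from \<open>p - 3\<close> back to \<open>p - 2\<close>.\<close>
  also have "(\<Sum>i\<in>Basis. (g \<bullet> i) * (H i \<bullet> sgn g)) = H (\<Sum>i\<in>Basis. (g \<bullet> i) *\<^sub>R i) \<bullet> sgn g"
    using bl by (simp add: linear_sum[OF bounded_linear.linear] inner_sum_left linear_simps)
  also have "\<dots> = n * (H (sgn g) \<bullet> sgn g)"
  proof -
    have "g = n *\<^sub>R sgn g" using n by (simp add: n_def sgn_div_norm)
    then have "H g = n *\<^sub>R H (sgn g)" using bl by (metis bounded_linear.linear linear_cmul)
    then show ?thesis by (simp add: euclidean_representation)
  qed
  also have "(p - 2) * n powr (p - 3) * (n * (H (sgn g) \<bullet> sgn g))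
      = (p - 2) * n powr (p - 2) * (H (sgn g) \<bullet> sgn g)"
  proof -
    have "n powr (p - 2) = n * n powr (p - 3)" using n powr_mult_base[of n "p - 3"] by simp
    then show ?thesis by simp
  qed
  finally show ?thesis by (simp add: hess_op_def n_def algebra_simps)
qed

lemma Lop_second_jet:
  assumes "second_jet f x g H" "g \<noteq> 0" "f x > 0"
  shows "Lop p V f x = - (norm g powr (p - 2) * (hess_op p H (sgn g) + V x * reaction p (f x) (norm g)))"
proof -
  have "spow \<bar>f x\<bar> (p - 2) = f x powr (p - 2)" using assms(3) by (simp add: spow_def)
  moreover have "norm g powr (p - 2) * reaction p (f x) (norm g) = f x powr (p - 2) * f x"
    using assms by (simp add: reaction_def powr_divide)
  ultimately show ?thesis
    unfolding Lop_def plap_second_jet[OF assms(1,2)]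
    by (simp add: distrib_left mult.left_commute[of _ "V x"] mult_ac)
qed

text \<open>The discarded factor \<open>norm g powr (p - 2)\<close> is positive and
  \<open>Lop\<close> carries a minus sign, so the inequalities are reversed. All comparisons below
  are made in this normalised form.\<close>

lemma Lop_sign_iff:
  assumes "second_jet f x g H" "g \<noteq> 0" "f x > 0"
  shows "Lop p V f x > 0 \<longleftrightarrow> hess_op p H (sgn g) + V x * reaction p (f x) (norm g) < 0"
    and "Lop p V f x \<ge> 0 \<longleftrightarrow> hess_op p H (sgn g) + V x * reaction p (f x) (norm g) \<le> 0"
    and "Lop p V f x \<le> 0 \<longleftrightarrow> hess_op p H (sgn g) + V x * reaction p (f x) (norm g) \<ge> 0"
  using assms(2) unfolding Lop_second_jet[OF assms]
  by (auto simp: mult_less_0_iff mult_le_0_iff zero_le_mult_iff not_less)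

section \<open>Homogeneity and subadditivity of the zero-order term\<close>

lemma reaction_scale: "c > 0 \<Longrightarrow> reaction p (c * a) (c * b) = c * reaction p a b"
  by (simp add: reaction_def)

text \<open>Written as \<open>b * (a / b) powr (p - 1)\<close>, the claim is convexity of the power
  \<open>p - 1 \<ge> 1\<close>: the quotient \<open>(a + a') / (b + b')\<close> is the mean of
  \<open>a / b\<close> and \<open>a' / b'\<close> with weights proportional to \<open>b\<close> and
  \<open>b'\<close>.\<close>

lemma reaction_subadditive:
  assumes "p \<ge> 2" "a > 0" "b > 0" "a' > 0" "b' > 0"
  shows "reaction p (a + a') (b + b') \<le> reaction p a b + reaction p a' b'"
proof -
  have r: "reaction p s y = y * (s / y) powr (p - 1)" if "s > 0" "y > 0" for s y
    using that powr_mult_base[of "s / y" "p - 2"] by (simp add: reaction_def field_simps)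
  have "convex_on {0<..} (\<lambda>x. x powr (p - 1))" using assms by (intro powr_convex) simp
  moreover have "a / b \<in> {0<..}" "a' / b' \<in> {0<..}" using assms by auto
  ultimately have "((b / (b + b')) *\<^sub>R (a / b) + (b' / (b + b')) *\<^sub>R (a' / b')) powr (p - 1)
      \<le> b / (b + b') * (a / b) powr (p - 1) + b' / (b + b') * (a' / b') powr (p - 1)"
    using assms
    by (intro convex_on_def[THEN iffD1, THEN conjunct2, rule_format])
      (simp_all only: greaterThan_iff, simp_all add: add_divide_distrib[symmetric])
  then have "((a + a') / (b + b')) powr (p - 1)
      \<le> (b * (a / b) powr (p - 1) + b' * (a' / b') powr (p - 1)) / (b + b')"
    using assms by (simp add: add_divide_distrib)
  then show ?thesis using assms by (simp add: r field_simps)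
qed


text \<open>At the touching point the gradients satisfy \<open>g = c *\<^sub>R g'\<close>, so they
  share a direction, and by homogeneity the zero-order terms differ by exactly the factor
  \<open>c\<close>. Only the Hessian parts contribute an inequality.\<close>

lemma touching_operator_le:
  fixes f w :: "'a::euclidean_space \<Rightarrow> real"
  assumes "second_jet f x g H" "second_jet w x g' H'" "2 \<le> p" "c > 0"
    and "f x = c * w x" "eventually (\<lambda>y. f y \<le> c * w y) (nhds x)"
  shows "hess_op p H (sgn g) + V x * reaction p (f x) (norm g)
    \<le> c * (hess_op p H' (sgn g') + V x * reaction p (w x) (norm g'))"
proof -
  note touch = touching_above[OF assms(1,2,3,5,6)]
  have "sgn g = sgn g'" "norm g = c * norm g'"
    using assms(4) by (simp_all add: touch(1) sgn_scaleR)
  then show ?thesis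
    using touch(2)[of "sgn g'"] assms(4,5) by (simp add: reaction_scale algebra_simps)
qed

section \<open>Annuli, radial gradients and the outer boundary\<close>

lemma open_annulus_open: "open (annulus_open r0 R0 :: 'a::euclidean_space set)"
proof -
  have "annulus_open r0 R0 = {x::'a. r0 < norm x} \<inter> {x. ereal (norm x) < R0}"
    by (auto simp: annulus_open_def)
  moreover have "open ({x::'a. r0 < norm x} \<inter> {x. ereal (norm x) < R0})"
    by (intro open_Int open_Collect_less continuous_intros)
  ultimately show ?thesis by simp
qed

lemma annulus_open_subset_hc: "annulus_open r0 R0 \<subseteq> annulus_hc r0 R0"
  by (auto simp: annulus_open_def annulus_hc_def)

lemma C2_on_second_jet:
  assumes "C2_on (annulus_hc r0 R0) f" "x \<in> annulus_open r0 R0"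
  obtains g H where "second_jet f x g H"
proof -
  obtain G H where d: "\<And>y. y \<in> annulus_hc r0 R0 \<Longrightarrow> (f has_derivative (\<lambda>h. G y \<bullet> h)) (at y within annulus_hc r0 R0)"
    "\<And>y. y \<in> annulus_hc r0 R0 \<Longrightarrow> (G has_derivative H y) (at y within annulus_hc r0 R0)"
    using assms(1) unfolding C2_on_def by blast
  have int: "at y within annulus_hc r0 R0 = at y" if "y \<in> annulus_open r0 R0" for y :: 'a
    using that interiorI[OF open_annulus_open _ annulus_open_subset_hc] by (intro at_within_interior)
  have "\<forall>y\<in>annulus_open r0 R0. (f has_derivative (\<lambda>h. G y \<bullet> h)) (at y)"
    using d(1) int annulus_open_subset_hc by fastforce
  moreover have "(G has_derivative H x) (at x)"
    using d(2)[of x] int[of x] assms(2) annulus_open_subset_hc by (auto simp: subset_iff)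
  ultimately have "second_jet f x (G x) (H x)"
    unfolding second_jet_def using assms(2) open_annulus_open by blast
  then show thesis by (rule that)
qed

lemma C2_on_continuous_on: "C2_on S f \<Longrightarrow> continuous_on S f"
  unfolding C2_on_def by (elim exE conjE) (rule has_derivative_continuous_on, blast)

text \<open>Chain rule through the norm; the one-sided derivative of the profile is two-sided
  because \<open>norm x > r0\<close>.\<close>

lemma second_jet_radial:
  assumes "second_jet f x g H" "radial_with r0 R0 f \<phi>" "x \<in> annulus_open r0 R0" "0 < r0"
    and "(\<phi> has_real_derivative d) (at (norm x) within {r0..})"
  shows "g = d *\<^sub>R sgn x"
proof -
  have x: "r0 < norm x" using assms(3) by (simp add: annulus_open_def)
  then have "at (norm x) within {r0..} = at (norm x)"
    by (intro at_within_interior) simp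
  with assms(5) have "(\<phi> has_derivative (*) d) (at (norm x))"
    by (simp add: has_field_derivative_def)
  moreover have "(norm has_derivative (\<lambda>h. sgn x \<bullet> h)) (at x)"
    using has_derivative_norm[of x] x assms(4) by (fastforce simp: inner_commute)
  ultimately have "((\<lambda>y. \<phi> (norm y)) has_derivative (\<lambda>h. d * (sgn x \<bullet> h))) (at x)"
    using has_derivative_compose by blast
  then have "(f has_derivative (\<lambda>h. d * (sgn x \<bullet> h))) (at x)"
    using assms(2) annulus_open_subset_hc[of r0 R0]
    by (elim has_derivative_transform_within_open[OF _ open_annulus_open assms(3)])
      (auto simp: radial_with_def)
  from has_derivative_unique[OF this second_jet_has_derivative[OF assms(1)]]
  have "d * (sgn x \<bullet> h) = g \<bullet> h" for h by metis
  then have "(d *\<^sub>R sgn x) \<bullet> h = g \<bullet> h" for h by simp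
  then show ?thesis by (metis vector_eq_rdot)
qed

text \<open>Turns the upper limit into a uniform bound on a whole shell next to the outer boundary,
  for finite and infinite \<open>R0\<close> alike.\<close>

lemma eventually_less_near_outer:
  assumes "ereal r0 < R0" "Limsup (to_outer R0) (\<lambda>x. ereal (f x)) < ereal M"
  obtains b where "b < R0" "\<And>x. b < ereal (norm x) \<Longrightarrow> ereal (norm x) < R0 \<Longrightarrow> f x < M"
proof -
  have "eventually (\<lambda>x. ereal (f x) < ereal M) (to_outer R0)"
    using assms(2) by (rule Limsup_lessD)
  then obtain Q where Q: "eventually Q (at_left R0)" "\<And>x. Q (ereal (norm x)) \<Longrightarrow> f x < M"
    unfolding to_outer_def eventually_filtercomap by auto
  then show thesis
    using that unfolding eventually_at_left[OF assms(1)] by blast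
qed

section \<open>Comparison of the radial functions \<open>u\<close> and \<open>v\<close>\<close>

locale radial_comparison =
  fixes p r0 :: real and R0 :: ereal and V u v :: "'a::euclidean_space \<Rightarrow> real"
    and \<phi> \<psi> :: "real \<Rightarrow> real"
  assumes p: "2 \<le> p" and r0: "0 < r0" and R0: "ereal r0 < R0"
    and subsol: "C2_subsol p V r0 R0 u"
    and supersol: "C2_strict_supersol p V r0 R0 v"
    and v_pos: "x \<in> annulus_hc r0 R0 \<Longrightarrow> 0 < v x"
    and u_radial: "radial_with r0 R0 u \<phi>"
    and v_radial: "radial_with r0 R0 v \<psi>"
    and \<phi>_deriv: "r0 \<le> r \<Longrightarrow> ereal r < R0 \<Longrightarrow> \<exists>d. (\<phi> has_real_derivative d) (at r within {r0..})"
    and \<psi>_deriv: "r0 \<le> r \<Longrightarrow> ereal r < R0 \<Longrightarrow> \<exists>d>0. (\<psi> has_real_derivative d) (at r within {r0..})"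
    and \<phi>_init: "0 \<le> \<phi> r0"
begin

lemma u_eq: "r0 \<le> norm x \<Longrightarrow> ereal (norm x) < R0 \<Longrightarrow> u x = \<phi> (norm x)"
  and v_eq: "r0 \<le> norm x \<Longrightarrow> ereal (norm x) < R0 \<Longrightarrow> v x = \<psi> (norm x)"
  using u_radial v_radial by (auto simp: radial_with_def annulus_hc_def)

lemma \<psi>_pos:
  assumes "r0 \<le> r" "ereal r < R0"
  shows "0 < \<psi> r"
proof -
  obtain b :: 'a where "norm b = 1" using vector_choose_size[of 1] by auto
  then have "norm (r *\<^sub>R b) = r" using assms r0 by simp
  then show ?thesis
    using v_pos[of "r *\<^sub>R b"] v_eq[of "r *\<^sub>R b"] assms by (simp add: annulus_hc_def)
qed

text \<open>The positive derivative of \<open>\<psi>\<close> makes the gradient of \<open>v\<close>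
  nonzero, and touching passes this on to \<open>u\<close>. The normalised expression is then
  nonnegative for \<open>u\<close> and negative for \<open>v\<close>, against
  \<open>touching_operator_le\<close>.\<close>

lemma not_touching:
  assumes x: "x \<in> annulus_open r0 R0" and "0 < c" "u x = c * v x"
    and "eventually (\<lambda>y. u y \<le> c * v y) (nhds x)"
  shows False
proof -
  have bd: "r0 \<le> norm x" "ereal (norm x) < R0" "x \<noteq> 0" using x r0 by (auto simp: annulus_open_def)
  have vx: "0 < v x" using v_pos x annulus_open_subset_hc by blast
  obtain g H where u: "second_jet u x g H"
    using C2_on_second_jet x subsol unfolding C2_subsol_def by blast
  obtain g' H' where v: "second_jet v x g' H'"
    using C2_on_second_jet x supersol unfolding C2_strict_supersol_def by blast
  obtain d where "d > 0" "(\<psi> has_real_derivative d) (at (norm x) within {r0..})"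
    using \<psi>_deriv bd by blast
  then have "g' \<noteq> 0" using second_jet_radial[OF v v_radial x r0] bd by (simp add: sgn_zero_iff)
  moreover from this have "g \<noteq> 0"
    using touching_above(1)[OF u v p assms(3,4)] assms(2) by simp
  moreover have "0 < u x" using assms vx by simp
  ultimately have "0 \<le> hess_op p H (sgn g) + V x * reaction p (u x) (norm g)"
    "hess_op p H' (sgn g') + V x * reaction p (v x) (norm g') < 0"
    using subsol supersol x vx Lop_sign_iff(3)[OF u] Lop_sign_iff(1)[OF v]
    unfolding C2_subsol_def C2_strict_supersol_def by auto
  with touching_operator_le[OF u v p assms(2,3,4), of V] show False
    using assms(2) by (smt (verit) mult_pos_neg)
qed

text \<open>If the quotient dropped between \<open>r\<close> and \<open>s\<close>, its maximum over
  \<open>{r0..s}\<close> would be interior: \<open>r\<close> beats \<open>r0\<close> by assumption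
  and \<open>s\<close> by the drop. There \<open>u\<close> would touch a multiple of
  \<open>v\<close>, a positive one because the quotient starts at a nonnegative value.\<close>

lemma quotient_increasing:
  assumes "r0 < r" "r < s" "ereal s < R0" "\<phi> r0 / \<psi> r0 < \<phi> r / \<psi> r"
  shows "\<phi> r / \<psi> r \<le> \<phi> s / \<psi> s"
proof (rule ccontr)
  assume less: "\<not> ?thesis"
  define q where "q = (\<lambda>r. \<phi> r / \<psi> r)"
  have lt: "ereal t < R0" if "t \<le> s" for t
    using that assms(3) by (meson ereal_less_eq(3) le_less_trans)
  have "continuous_on {r0..s} f"
    if "\<And>r. r0 \<le> r \<Longrightarrow> ereal r < R0 \<Longrightarrow> \<exists>d. (f has_real_derivative d) (at r within {r0..})"
    for f :: "real \<Rightarrow> real"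
    unfolding continuous_on_eq_continuous_within
  proof
    fix r assume "r \<in> {r0..s}"
    then have "continuous (at r within {r0..}) f"
      using that[of r] lt by (auto dest: DERIV_continuous)
    then show "continuous (at r within {r0..s}) f"
      by (rule continuous_within_subset) auto
  qed
  then have "continuous_on {r0..s} \<phi>" "continuous_on {r0..s} \<psi>"
    using \<phi>_deriv \<psi>_deriv by blast+
  then have "continuous_on {r0..s} q"
    unfolding q_def using \<psi>_pos lt by (intro continuous_intros) force+
  then obtain m where m: "m \<in> {r0..s}" "\<And>t. t \<in> {r0..s} \<Longrightarrow> q t \<le> q m"
    using continuous_attains_sup[of "{r0..s}" q] assms by auto
  have "q r \<le> q m" using m(2)[of r] assms by simp
  with less assms(4) have "m \<noteq> r0" "m \<noteq> s" by (auto simp: q_def)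
  with m(1) have m': "r0 < m" "m < s" by auto
  have "0 \<le> q r0" using \<phi>_init \<psi>_pos[of r0] R0 by (simp add: q_def)
  with \<open>q r \<le> q m\<close> assms(4) have qm: "0 < q m" by (simp add: q_def)
  \<comment> \<open>By radial symmetry any point of the sphere of radius \<open>m\<close> is a
    touching point.\<close>
  obtain b :: 'a where b: "norm b = 1" using vector_choose_size[of 1] by auto
  define x where "x = m *\<^sub>R b"
  have x: "norm x = m" using b m' r0 by (simp add: x_def)
  have uv: "u y = q (norm y) * v y" if "r0 \<le> norm y" "norm y \<le> s" for y
    using that u_eq[of y] v_eq[of y] lt[of "norm y"] \<psi>_pos[of "norm y"] by (simp add: q_def)
  show False
  proof (rule not_touching[OF _ qm])
    show "x \<in> annulus_open r0 R0" using x m' lt by (simp add: annulus_open_def)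
    show "u x = q m * v x" using uv[of x] x m' by simp
    have "eventually (\<lambda>y. y \<in> {y. r0 < norm y} \<inter> {y. norm y < s}) (nhds x)"
      by (rule eventually_nhds_in_open)
        (auto intro!: open_Collect_less continuous_intros simp: x m')
    then show "eventually (\<lambda>y. u y \<le> q m * v y) (nhds x)"
    proof eventually_elim
      case (elim y)
      then have y: "r0 \<le> norm y" "norm y \<le> s" by auto
      then have "0 < v y" using v_pos[of y] lt[of "norm y"] by (simp add: annulus_hc_def)
      with y show ?case by (simp add: uv m(2))
    qed
  qed
qed

text \<open>Infinitesimal form of the monotonicity: if \<open>d < c * d'\<close> for the quotient
  \<open>c\<close> at \<open>r\<close>, then \<open>\<phi> - c \<psi>\<close> falls below 0 just to
  the right of \<open>r\<close>, and the quotient falls below \<open>c\<close>.\<close>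

lemma derivative_quotient_le:
  assumes "r0 < r" "ereal r < R0" "\<phi> r0 / \<psi> r0 < \<phi> r / \<psi> r"
    and "(\<phi> has_real_derivative d) (at r within {r0..})"
    and "(\<psi> has_real_derivative d') (at r within {r0..})"
  shows "\<phi> r / \<psi> r * d' \<le> d"
proof (rule ccontr)
  assume neg: "\<not> ?thesis"
  define c where "c = \<phi> r / \<psi> r"
  have "((\<lambda>s. \<phi> s - c * \<psi> s) has_real_derivative (d - c * d')) (at r within {r0..})"
    by (auto intro!: derivative_eq_intros assms(4,5))
  from has_real_derivative_neg_dec_right[OF this] neg
  obtain \<delta> where \<delta>: "0 < \<delta>" "\<And>h. 0 < h \<Longrightarrow> r0 \<le> r + h \<Longrightarrow> h < \<delta> \<Longrightarrow>
      \<phi> (r + h) - c * \<psi> (r + h) < \<phi> r - c * \<psi> r"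
    by (auto simp: c_def)
  obtain s where s: "r < s" "ereal s < R0"
    using ereal_dense2[OF assms(2)] by auto
  define h where "h = min (\<delta> / 2) (s - r)"
  have h: "0 < h" "h < \<delta>" "r + h \<le> s" using \<delta>(1) s by (auto simp: h_def)
  then have rh: "ereal (r + h) < R0" using s by (meson ereal_less_eq(3) le_less_trans)
  have "0 < \<psi> r" "0 < \<psi> (r + h)" using \<psi>_pos[of r] \<psi>_pos[of "r + h"] assms h rh by auto
  then have "\<phi> (r + h) < c * \<psi> (r + h)" using \<delta>(2)[of h] h assms(1) by (simp add: c_def)
  moreover have "c \<le> \<phi> (r + h) / \<psi> (r + h)"
    using quotient_increasing[of r "r + h"] h rh assms by (simp add: c_def)
  ultimately show False using \<open>0 < \<psi> (r + h)\<close> by (simp add: field_simps)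
qed

text \<open>The gradients of \<open>u\<close>, of \<open>v\<close> and of the difference are
  positive multiples of one unit vector \<open>e\<close>. Hence the Hessian parts subtract exactly,
  subadditivity handles the zero-order parts, and strictness comes from \<open>v\<close> since
  \<open>\<tau> > 0\<close>.\<close>

lemma difference_strict_subsolution:
  assumes x: "x \<in> annulus_open r0 R0" and V: "0 \<le> V x"
    and \<tau>: "0 < \<tau>" "\<phi> r0 / \<psi> r0 \<le> \<tau>" "\<tau> * v x < u x"
  obtains g H where "second_jet (\<lambda>y. u y - \<tau> * v y) x g H" "g \<noteq> 0"
    "0 < hess_op p H (sgn g) + V x * reaction p (u x - \<tau> * v x) (norm g)"
proof -
  have bd: "r0 < norm x" "ereal (norm x) < R0" "x \<noteq> 0" using x r0 by (auto simp: annulus_open_def)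
  have vx: "0 < v x" using v_pos x annulus_open_subset_hc by blast
  obtain g H where u: "second_jet u x g H"
    using C2_on_second_jet x subsol unfolding C2_subsol_def by blast
  obtain g' H' where v: "second_jet v x g' H'"
    using C2_on_second_jet x supersol unfolding C2_strict_supersol_def by blast
  obtain d' where d': "d' > 0" "(\<psi> has_real_derivative d') (at (norm x) within {r0..})"
    using \<psi>_deriv[of "norm x"] bd by auto
  obtain d where d: "(\<phi> has_real_derivative d) (at (norm x) within {r0..})"
    using \<phi>_deriv[of "norm x"] bd by auto
  define e where "e = sgn x"
  have e: "norm e = 1" "sgn e = e" using bd by (simp_all add: e_def sgn_div_norm)
  have g: "g = d *\<^sub>R e" "g' = d' *\<^sub>R e"
    unfolding e_def using second_jet_radial[OF u u_radial x r0 d] second_jet_radial[OF v v_radial x r0 d'(2)] by auto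
  \<comment> \<open>The quotient exceeds \<open>\<tau>\<close>, hence its initial value, so it
    cannot be decreasing here; this yields \<open>d > \<tau> * d'\<close>.\<close>
  have q: "\<tau> < \<phi> (norm x) / \<psi> (norm x)"
    using \<tau>(3) vx u_eq[of x] v_eq[of x] bd by (simp add: field_simps)
  with \<tau>(2) have "\<phi> (norm x) / \<psi> (norm x) * d' \<le> d"
    by (intro derivative_quotient_le d d' bd) simp
  moreover have "\<tau> * d' < \<phi> (norm x) / \<psi> (norm x) * d'"
    using q d'(1) by (rule mult_strict_right_mono)
  ultimately have dz: "0 < d - \<tau> * d'" by simp
  moreover have "0 < \<tau> * d'" using \<tau> d' by simp
  ultimately have dpos: "0 < d" by linarith
  have ux: "0 < u x" using \<tau> vx by (smt (verit) mult_pos_pos)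
  have nz: "g \<noteq> 0" "g' \<noteq> 0" using dpos d' e by (auto simp: g)
  have "0 \<le> hess_op p H e + V x * reaction p (u x) d"
    using Lop_sign_iff(3)[OF u nz(1) ux, of p V] subsol x dpos e
    by (simp add: C2_subsol_def g sgn_scaleR)
  moreover have "hess_op p H' e + V x * reaction p (v x) d' < 0"
    using Lop_sign_iff(1)[OF v nz(2) vx, of p V] supersol x d' e
    by (simp add: C2_strict_supersol_def g sgn_scaleR)
  then have "\<tau> * (hess_op p H' e + V x * reaction p (v x) d') < 0"
    using \<tau>(1) by (rule mult_pos_neg[rotated])
  \<comment> \<open>Subadditivity for the splittings of \<open>u x\<close> into
    \<open>u x - \<tau> * v x\<close> and \<open>\<tau> * v x\<close>, and of \<open>d\<close> into
    \<open>d - \<tau> * d'\<close> and \<open>\<tau> * d'\<close>.\<close>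
  moreover have "reaction p (u x) d \<le> reaction p (u x - \<tau> * v x) (d - \<tau> * d') + \<tau> * reaction p (v x) d'"
    using reaction_subadditive[OF p, of "u x - \<tau> * v x" "d - \<tau> * d'" "\<tau> * v x" "\<tau> * d'"] \<tau> dz vx d'
    by (simp add: reaction_scale)
  from mult_left_mono[OF this V]
  have "V x * reaction p (u x) d \<le> V x * reaction p (u x - \<tau> * v x) (d - \<tau> * d') + \<tau> * (V x * reaction p (v x) d')"
    by (simp add: algebra_simps)
  ultimately have pos: "0 < hess_op p (\<lambda>h. H h - \<tau> *\<^sub>R H' h) e + V x * reaction p (u x - \<tau> * v x) (d - \<tau> * d')"
    unfolding hess_op_diff_scaled by (simp add: algebra_simps)
  have gz: "g - \<tau> *\<^sub>R g' = (d - \<tau> * d') *\<^sub>R e" by (simp add: g scaleR_left_diff_distrib)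
  have "sgn (g - \<tau> *\<^sub>R g') = e" "norm (g - \<tau> *\<^sub>R g') = d - \<tau> * d'"
    using dz e by (simp_all add: gz sgn_scaleR)
  with that[OF second_jet_diff_scaled[OF u v, of \<tau>]] pos dz show thesis by fastforce
qed

text \<open>Otherwise \<open>z / w\<close> has a positive maximum over a closed shell. It is not on
  the inner sphere, where \<open>z < 0\<close> by the choice of \<open>\<tau>\<close>, nor on the
  outer one, where \<open>u / w\<close> is already too small. At an interior maximum a multiple of
  \<open>w\<close> touches the strict subsolution \<open>z\<close> from above.\<close>

lemma Limsup_quotient_pos:
  assumes V: "\<And>x. x \<in> annulus_open r0 R0 \<Longrightarrow> 0 \<le> V x"
    and \<tau>: "0 < \<tau>" "\<phi> r0 / \<psi> r0 < \<tau>"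
    and y0: "y0 \<in> annulus_hc r0 R0" "\<tau> * v y0 < u y0"
    and w: "C2_supersol p V r0 R0 w" "\<And>x. x \<in> annulus_hc r0 R0 \<Longrightarrow> 0 < w x"
  shows "0 < Limsup (to_outer R0) (\<lambda>x. ereal (u x / w x))"
proof (rule ccontr)
  assume nonpos: "\<not> ?thesis"
  define z where "z = (\<lambda>y. u y - \<tau> * v y)"
  \<comment> \<open>The level of \<open>z / w\<close> at \<open>y0\<close>, which any maximum over a
    set containing \<open>y0\<close> must reach.\<close>
  define M where "M = z y0 / w y0"
  have "0 < M" using y0 w(2) by (simp add: M_def z_def)
  then have "Limsup (to_outer R0) (\<lambda>x. ereal (u x / w x)) < ereal M"
    using nonpos le_less_trans[of _ 0 "ereal M"] by simp
  then obtain b where b: "b < R0" "\<And>x. b < ereal (norm x) \<Longrightarrow> ereal (norm x) < R0 \<Longrightarrow> u x / w x < M"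
    using eventually_less_near_outer[OF R0, of "\<lambda>x. u x / w x" M] by blast
  have "max b (ereal (norm y0)) < R0" using b(1) y0 by (simp add: annulus_hc_def)
  \<comment> \<open>Beyond \<open>b\<close>, so that \<open>u / w < M\<close> on the outer sphere,
    and beyond \<open>norm y0\<close>, so that the shell contains \<open>y0\<close>.\<close>
  then obtain R1 where R1: "max b (ereal (norm y0)) < ereal R1" "ereal R1 < R0"
    using ereal_dense2 by blast
  define K where "K = cball 0 R1 - ball (0::'a) r0"
  have K: "K \<subseteq> annulus_hc r0 R0"
    using R1(2) by (auto simp: K_def annulus_hc_def) (meson ereal_less_eq(3) le_less_trans)
  have "compact K" unfolding K_def by (intro compact_diff) auto
  moreover have y0K: "y0 \<in> K" using R1 y0 by (auto simp: K_def annulus_hc_def)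
  moreover have "continuous_on K (\<lambda>x. z x / w x)"
  proof -
    have "continuous_on K u" "continuous_on K v" "continuous_on K w"
      using subsol supersol w K C2_on_continuous_on continuous_on_subset
      unfolding C2_subsol_def C2_strict_supersol_def C2_supersol_def by metis+
    then show ?thesis unfolding z_def using w(2) K
      by (intro continuous_intros) force+
  qed
  ultimately obtain x where x: "x \<in> K" "\<And>y. y \<in> K \<Longrightarrow> z y / w y \<le> z x / w x"
    using continuous_attains_sup[of K "\<lambda>x. z x / w x"] by blast
  define c where "c = z x / w x"
  have c: "M \<le> c" "0 < c" using x(2)[OF y0K] \<open>0 < M\<close> by (simp_all add: c_def M_def)
  have xK: "x \<in> annulus_hc r0 R0" "0 < w x" "0 < v x" using K x(1) w(2) v_pos by blast+
  have zx: "z x = c * w x" using xK by (simp add: c_def)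
  with c xK have zpos: "0 < z x" by simp
  have "norm x \<noteq> r0"
  proof
    assume "norm x = r0"
    then have "\<tau> * v x < u x" "u x = \<phi> r0" "v x = \<psi> r0"
      using zpos u_eq[of x] v_eq[of x] R0 by (auto simp: z_def)
    with \<tau>(2) xK(3) show False by (simp add: field_simps)
  qed
  moreover have "norm x \<noteq> R1"
  proof
    assume "norm x = R1"
    then have "u x / w x < M" using b(2)[of x] R1 by simp
    \<comment> \<open>Subtracting the positive \<open>\<tau> * v x\<close> only lowers the
      quotient.\<close>
    moreover have "z x / w x \<le> u x / w x" using xK \<tau> by (simp add: z_def divide_right_mono)
    ultimately show False using c by (simp add: c_def)
  qed
  ultimately have x': "r0 < norm x" "norm x < R1" using x(1) by (auto simp: K_def)
  then have xo: "x \<in> annulus_open r0 R0" using xK by (simp add: annulus_open_def annulus_hc_def)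
  have "eventually (\<lambda>y. y \<in> {y. r0 < norm y} \<inter> {y. norm y < R1}) (nhds x)"
    by (rule eventually_nhds_in_open)
      (auto intro!: open_Collect_less continuous_intros simp: x')
  then have touch: "eventually (\<lambda>y. z y \<le> c * w y) (nhds x)"
  proof eventually_elim
    case (elim y)
    then have y: "y \<in> K" by (auto simp: K_def)
    then have "0 < w y" using K w(2) by blast
    with x(2)[OF y] show ?case by (simp add: c_def pos_divide_le_eq)
  qed
  obtain g H where z: "second_jet z x g H" "g \<noteq> 0" "0 < hess_op p H (sgn g) + V x * reaction p (z x) (norm g)"
    using difference_strict_subsolution[OF xo V[OF xo] \<tau>(1) less_imp_le[OF \<tau>(2)]] zpos
    unfolding z_def by auto
  obtain g' H' where w': "second_jet w x g' H'"
    using C2_on_second_jet xo w(1) unfolding C2_supersol_def by blast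
  \<comment> \<open>\<open>w\<close> may have critical points elsewhere; here its gradient inherits
    nonvanishing from \<open>z\<close>, so its inequality can be normalised.\<close>
  have "g' \<noteq> 0" using touching_above(1)[OF z(1) w' p zx touch] z(2) by auto
  then have "hess_op p H' (sgn g') + V x * reaction p (w x) (norm g') \<le> 0"
    using Lop_sign_iff(2)[OF w' _ xK(2), of p V] w(1) xo by (simp add: C2_supersol_def)
  with touching_operator_le[OF z(1) w' p c(2) zx touch, of V] z(3) c(2) show False
    by (smt (verit) mult_nonneg_nonpos)
qed

end

section \<open>The dichotomy between boundedness by \<open>v\<close> and a positive upper
  limit\<close>

theorem theorem3p10:
  fixes p r0 :: real and R0 :: ereal and V u :: "'a::euclidean_space \<Rightarrow> real"
  assumes "DIM('a) \<ge> 2"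
    and "p \<ge> 2"
    and "0 < r0" and "ereal r0 < R0"
    and "continuous_on (annulus_open r0 R0) V"
    and "\<forall>x\<in>annulus_open r0 R0. V x \<ge> 0"
    and "\<exists>v::'a \<Rightarrow> real. (\<forall>x\<in>annulus_hc r0 R0. v x > 0) \<and> radial_strict_mono_incr r0 R0 v
            \<and> C2_strict_supersol p V r0 R0 v"
    and "radial_mono_incr r0 R0 u" and "C2_subsol p V r0 R0 u"
    and "\<forall>x. norm x = r0 \<longrightarrow> u x \<ge> 0"
  shows "(\<forall>v. (\<forall>x\<in>annulus_hc r0 R0. v x > 0) \<and> radial_strict_mono_incr r0 R0 v
              \<and> C2_strict_supersol p V r0 R0 v
              \<longrightarrow> (\<exists>C>0. \<forall>x\<in>annulus_hc r0 R0. u x \<le> C * v x))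
       \<or> (\<forall>w. (\<forall>x\<in>annulus_hc r0 R0. w x > 0) \<and> C2_supersol p V r0 R0 w
              \<longrightarrow> Limsup (to_outer R0) (\<lambda>x. ereal (u x / w x)) > 0)"
proof (rule disjCI, intro allI impI)
  fix v :: "'a \<Rightarrow> real"
  assume not_ii: "\<not> (\<forall>w. (\<forall>x\<in>annulus_hc r0 R0. w x > 0) \<and> C2_supersol p V r0 R0 w
              \<longrightarrow> Limsup (to_outer R0) (\<lambda>x. ereal (u x / w x)) > 0)"
    and v: "(\<forall>x\<in>annulus_hc r0 R0. v x > 0) \<and> radial_strict_mono_incr r0 R0 v
              \<and> C2_strict_supersol p V r0 R0 v"
  obtain \<phi> where \<phi>: "radial_with r0 R0 u \<phi>"
    "\<And>r. r0 \<le> r \<Longrightarrow> ereal r < R0 \<Longrightarrow> \<exists>d. (\<phi> has_real_derivative d) (at r within {r0..})"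
    using assms(8) unfolding radial_mono_incr_def by blast
  obtain \<psi> where \<psi>: "radial_with r0 R0 v \<psi>"
    "\<And>r. r0 \<le> r \<Longrightarrow> ereal r < R0 \<Longrightarrow> \<exists>d>0. (\<psi> has_real_derivative d) (at r within {r0..})"
    using v unfolding radial_strict_mono_incr_def by blast
  obtain x0 :: 'a where "norm x0 = r0" using vector_choose_size[of r0] assms(3) by auto
  then have "0 \<le> \<phi> r0"
    using assms(4,10) \<phi>(1) by (auto simp: radial_with_def annulus_hc_def)
  interpret radial_comparison p r0 R0 V u v \<phi> \<psi>
    using assms \<phi> \<psi> v \<open>0 \<le> \<phi> r0\<close> by unfold_locales auto
  \<comment> \<open>Strictly above the initial quotient and positive. The same \<open>\<tau>\<close>
    is the candidate for \<open>C\<close>: if it fails, a point \<open>y0\<close> with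
    \<open>\<tau> * v y0 < u y0\<close> exists and forces the second alternative.\<close>
  define \<tau> where "\<tau> = \<phi> r0 / \<psi> r0 + 1"
  have "0 \<le> \<phi> r0 / \<psi> r0" using \<phi>_init \<psi>_pos[of r0] R0 by simp
  then have \<tau>: "0 < \<tau>" "\<phi> r0 / \<psi> r0 < \<tau>" by (simp_all add: \<tau>_def)
  show "\<exists>C>0. \<forall>x\<in>annulus_hc r0 R0. u x \<le> C * v x"
  proof (rule ccontr)
    assume "\<not> ?thesis"
    with \<tau>(1) obtain y0 where "y0 \<in> annulus_hc r0 R0" "\<tau> * v y0 < u y0"
      by (meson not_less)
    then show False using Limsup_quotient_pos[OF _ \<tau>] assms(6) not_ii by blast
  qed
qed

end
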